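(* (Converse duality) Let $(\bar x,\bar y^*,\bar\mu)\in C_D$ be such that $\bar x\in C$. (i) If $(f\circ F,g\circ G)$ is type I pseudo convex at $\bar x$, then $\bar x\in\mathcal S^w(\mathrm{CRP})$. (ii) If $(f\circ F,g\circ G)$ is type II pseudo convex at $\bar x$, then $\bar x\in\mathcal S(\mathrm{CRP})$.
   Context: Setting. $X,W,Y,Z$ are Asplund spaces; $F:X\to W$, $f:W\to Y$; $K\subset Y$ is a pointed closed convex cone with nonempty interior; $K^+=\{y^*\in Y^*\mid\langle y^*,y\rangle\ge 0\ \forall y\in K\}$. For $i=1,\dots,n$, $\mathcal V_i$ is a (nonempty) sequentially compact topological space, $\mathcal U_i$ a topological space, $G_i:X\times\mathcal V_i\to Z\times\mathcal U_i$, $g_i:Z\times\mathcal U_i\to\mathbb R$. The primal robust problem $(\mathrm{CRP})$ is: minimize $(f\circ F)(x)$ with respect to $K$ over $C=\{x\in X\mid (g_i\circ G_i)(x,v_i)\le 0\ \forall v_i\in\mathcal V_i,\ i=1,\dots,n\}$; $\bar x\in\mathcal S(\mathrm{CRP})$ (resp. $\mathcal S^w(\mathrm{CRP})$) means $\bar x\in C$ and $(f\circ F)(x)-(f\circ F)(\bar x)\notin-K\setminus\{0\}$ (resp. $\notin-\mathrm{int}\,K$) for all $x\in C$. Notation. $\partial$ is the limiting (Mordukhovich) subdifferential. $\langle y^*,f\rangle(w):=\langle y^*,f(w)\rangle$. $\mathrm{cl}^*\mathrm{co}$ is the weak$^*$ closed convex hull. $\partial_x$ is the limiting subdifferential in the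 first variable with the parameter held fixed; writing $G_i(x,v_i)=(\tilde G_i(x,v_i),\gamma_i(x,v_i))\in Z\times\mathcal U_i$, $\partial_x g_i(G_i(z,v_i))\subset Z^*$ is the limiting subdifferential of $g_i(\cdot,\gamma_i(z,v_i))$ at $\tilde G_i(z,v_i)$, and $\langle v_i^*,G_i\rangle(x,v_i):=\langle v_i^*,\tilde G_i(x,v_i)\rangle$. Put $\phi_i(x)=\max_{v_i\in\mathcal V_i}(g_i\circ G_i)(x,v_i)$, $\phi=\max_i\phi_i$, $\mathcal V_i(z)=\{v_i\in\mathcal V_i\mid(g_i\circ G_i)(z,v_i)=\phi_i(z)\}$. Standing assumptions at $\bar x$. (A1) $F$ is locally Lipschitz at $\bar x$ and $f$ at $F(\bar x)$. (A2) $\tilde G_i(\cdot,v_i)$ is Lipschitz on a neighborhood of $\bar x$ uniformly in $v_i\in\mathcal V_i$, and $g_i$ is Lipschitz in its $Z$-variable (uniformly) around the points of $G_i(\bar x,\mathcal V_i)$. (A3) $v_i\mapsto G_i(\bar x,v_i)$ and $g_i$ on $G_i(\bar x,\mathcal V_i)$ are locally Lipschitz (with respect to metrics inducing the topologies of $\mathcal V_i,\mathcal U_i$). (A4) $\phi_i,\phi$ are well-defined real-valued functions on $X$ (maxima attained), locally Lipschitz at $\bar x$. (A5) The multifunction $(x,v_i)\mapsto\partial_x(g_i\circ G_i)(x,v_i)$ is weak$^*$ sequentially closed at $(\bar x,\bar v_i)$ for each $\bar v_i\in\mathcal V_i(\bar x)$. Dual feasible set. $C_D$ is the set of all $(z,y^*,\mu)\in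 X\times(K^+\setminus\{0\})\times\mathbb R^n_+$ such that $$0\in\bigcup_{w^*\in\partial\langle y^*,f\rangle(F(z))}\partial\langle w^*,F\rangle(z)+\sum_{i=1}^n\mu_i\,\mathrm{cl}^*\mathrm{co}\Big(\bigcup\Big\{\bigcup_{v_i^*\in\partial_x g_i(G_i(z,v_i))}\partial_x\langle v_i^*,G_i\rangle(z,v_i)\Big|v_i\in\mathcal V_i(z)\Big\}\Big)$$ and $\mu_i\,g_i(G_i(z,v_i))\ge 0$ for $v_i\in\mathcal V_i(z)$, $i=1,\dots,n$. Pseudo convexity. $(f\circ F,g\circ G)$ is type I pseudo convex at $\bar x$ if for any $x\in X$, $y^*\in K^+$, $w^*\in\partial\langle y^*,f\rangle(F(\bar x))$, $x^*\in\partial\langle w^*,F\rangle(\bar x)$, $v_i^*\in\partial_x g_i(G_i(\bar x,v_i))$, and $x_i^*\in\partial_x\langle v_i^*,G_i\rangle(\bar x,v_i)$, $v_i\in\mathcal V_i(\bar x)$, $i=1,\dots,n$, there exists $\nu\in X$ such that $\langle y^*,f\circ F\rangle(x)<\langle y^*,f\circ F\rangle(\bar x)\Rightarrow\langle x^*,\nu\rangle<0$, and $(g_i\circ G_i)(x,v_i)\le(g_i\circ G_i)(\bar x,v_i)\Rightarrow\langle x_i^*,\nu\rangle\le 0$, $i=1,\dots,n$. It is type II pseudo convex at $\bar x$ if the same holds for any $x\in X\setminus\{\bar x\}$ and $y^*\in K^+\setminus\{0\}$ (other data as before), with the first implication replaced by $\langle y^*,f\circ F\rangle(x)\le\langle y^*,f\circ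 F\rangle(\bar x)\Rightarrow\langle x^*,\nu\rangle<0$.
   Formalization: In both types of pseudo convexity, ν may depend on x, y*, w*, x* but must serve all i, v_i, v_i*, x_i* at once; if ν may vary with each choice of v_i, v_i*, x_i*, as literally written, the claim is false. *)

theory Defs
  imports "HOL-Analysis.Analysis"
begin

definition asplund :: "'a::banach itself \<Rightarrow> bool" where
  "asplund _ \<longleftrightarrow> (\<forall>(U :: 'a set) \<phi> :: 'a \<Rightarrow> real.
     open U \<longrightarrow> convex_on U \<phi> \<longrightarrow> continuous_on U \<phi> \<longrightarrow>
     U \<subseteq> closure {x \<in> U. \<phi> differentiable (at x)})"

text \<open>On the dual space the strong operator topology is the topology of pointwise
  convergence, that is, the weak$^*$ topology.\<close>

abbreviation weak_star :: "('a::real_normed_vector \<Rightarrow>\<^sub>L real) topology" where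
  "weak_star \<equiv> strong_operator_topology"

definition clco :: "('a::real_normed_vector \<Rightarrow>\<^sub>L real) set \<Rightarrow> ('a \<Rightarrow>\<^sub>L real) set" where
  "clco S = weak_star closure_of (convex hull S)"

definition frechet_normal_cone ::
    "'a::real_normed_vector set \<Rightarrow> 'a \<Rightarrow> ('a \<Rightarrow>\<^sub>L real) set" where
  "frechet_normal_cone S x = {l. x \<in> S \<and>
     Limsup (at x within S) (\<lambda>u. ereal (blinfun_apply l (u - x) / norm (u - x))) \<le> 0}"

text \<open>The limiting normal cone is the sequential Painleve-Kuratowski upper limit of the
  Frechet normal cones. In Asplund spaces no \<open>\<epsilon>\<close>-normals are needed.\<close>

definition limiting_normal_cone ::
    "'a::real_normed_vector set \<Rightarrow> 'a \<Rightarrow> ('a \<Rightarrow>\<^sub>L real) set" where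
  "limiting_normal_cone S x = {l. x \<in> S \<and> (\<exists>xs ls.
     (\<forall>k. xs k \<in> S \<and> ls k \<in> frechet_normal_cone S (xs k)) \<and>
     xs \<longlonglongrightarrow> x \<and> limitin weak_star ls l sequentially)}"

text \<open>\<open>x\<^sup>*\<close> is a limiting subgradient iff \<open>(x\<^sup>*, -1)\<close> is a limiting normal to the epigraph;
  the functional \<open>(x\<^sup>*, -1)\<close> maps \<open>(h, r)\<close> to \<open>x\<^sup>* h - r\<close>.\<close>

definition limiting_subdiff ::
    "('a::real_normed_vector \<Rightarrow> real) \<Rightarrow> 'a \<Rightarrow> ('a \<Rightarrow>\<^sub>L real) set" where
  "limiting_subdiff \<phi> x = {xs.
     (xs o\<^sub>L fst_blinfun) - snd_blinfun \<in> limiting_normal_cone (epigraph UNIV \<phi>) (x, \<phi> x)}"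

definition locally_lipschitz_at :: "('a::metric_space \<Rightarrow> 'b::metric_space) \<Rightarrow> 'a \<Rightarrow> bool" where
  "locally_lipschitz_at f x \<longleftrightarrow> (\<exists>N L. open N \<and> x \<in> N \<and> L-lipschitz_on N f)"

definition locally_lipschitz_map :: "'a metric \<Rightarrow> 'b metric \<Rightarrow> ('a \<Rightarrow> 'b) \<Rightarrow> bool" where
  "locally_lipschitz_map m1 m2 f \<longleftrightarrow> (\<forall>p \<in> mspace m1. \<exists>r>0.
     Lipschitz_continuous_map (submetric m1 (mball_of m1 p r)) m2 f)"

definition seq_compact_space :: "'a topology \<Rightarrow> bool" where
  "seq_compact_space T \<longleftrightarrow> (\<forall>\<sigma> :: nat \<Rightarrow> 'a. range \<sigma> \<subseteq> topspace T \<longrightarrow>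
     (\<exists>l r. strict_mono r \<and> limitin T (\<sigma> \<circ> r) l sequentially))"

definition ordering_cone :: "'y::real_normed_vector set \<Rightarrow> bool" where
  "ordering_cone K \<longleftrightarrow> closed K \<and> convex_cone K \<and> K \<inter> uminus ` K = {0} \<and> interior K \<noteq> {}"

definition dual_cone :: "'y::real_normed_vector set \<Rightarrow> ('y \<Rightarrow>\<^sub>L real) set" where
  "dual_cone K = {ys. \<forall>y\<in>K. 0 \<le> blinfun_apply ys y}"

text \<open>The spaces \<open>\<V>\<^sub>i\<close> and \<open>\<U>\<^sub>i\<close> are topologies on carrier sets inside the types \<open>'v\<close> and \<open>'u\<close>;
  the index set \<open>{1,...,n}\<close> is a finite type \<open>'n\<close>. The components of \<open>G i p\<close> are
  \<open>fst (G i p)\<close> in \<open>Z\<close> and \<open>snd (G i p)\<close> in \<open>\<U>\<^sub>i\<close>.\<close>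

definition feasible_set ::
    "('n \<Rightarrow> 'v topology) \<Rightarrow> ('n \<Rightarrow> 'x \<times> 'v \<Rightarrow> 'z \<times> 'u) \<Rightarrow> ('n \<Rightarrow> 'z \<times> 'u \<Rightarrow> real) \<Rightarrow> 'x set" where
  "feasible_set V G g = {x. \<forall>i. \<forall>v \<in> topspace (V i). g i (G i (x, v)) \<le> 0}"

definition efficient ::
    "'y::real_normed_vector set \<Rightarrow> 'x set \<Rightarrow> ('x \<Rightarrow> 'y) \<Rightarrow> 'x \<Rightarrow> bool" where
  "efficient K C h xb \<longleftrightarrow> xb \<in> C \<and> (\<forall>x\<in>C. h x - h xb \<notin> uminus ` K - {0})"

definition weakly_efficient ::
    "'y::real_normed_vector set \<Rightarrow> 'x set \<Rightarrow> ('x \<Rightarrow> 'y) \<Rightarrow> 'x \<Rightarrow> bool" where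
  "weakly_efficient K C h xb \<longleftrightarrow> xb \<in> C \<and> (\<forall>x\<in>C. h x - h xb \<notin> uminus ` interior K)"

text \<open>\<open>max_fun\<close> is \<open>\<phi>\<^sub>i\<close>; its supremum is a maximum under \<open>assumption_A4\<close>.\<close>

definition max_fun ::
    "('n \<Rightarrow> 'v topology) \<Rightarrow> ('n \<Rightarrow> 'x \<times> 'v \<Rightarrow> 'z \<times> 'u) \<Rightarrow> ('n \<Rightarrow> 'z \<times> 'u \<Rightarrow> real) \<Rightarrow> 'n \<Rightarrow> 'x \<Rightarrow> real"
  where "max_fun V G g i x = (SUP v \<in> topspace (V i). g i (G i (x, v)))"

definition active_set ::
    "('n \<Rightarrow> 'v topology) \<Rightarrow> ('n \<Rightarrow> 'x \<times> 'v \<Rightarrow> 'z \<times> 'u) \<Rightarrow> ('n \<Rightarrow> 'z \<times> 'u \<Rightarrow> real) \<Rightarrow> 'n \<Rightarrow> 'x \<Rightarrow> 'v set"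
  where "active_set V G g i z = {v \<in> topspace (V i). g i (G i (z, v)) = max_fun V G g i z}"

definition scalarize :: "('b::real_normed_vector \<Rightarrow>\<^sub>L real) \<Rightarrow> ('a \<Rightarrow> 'b) \<Rightarrow> 'a \<Rightarrow> real" where
  "scalarize ys f x = blinfun_apply ys (f x)"

text \<open>\<open>subdiff_g G g i z v\<close> is $\partial_x g_i(G_i(z,v))$ and \<open>subdiff_G G i vs z v\<close> is
  $\partial_x\langle v_i^*, G_i\rangle(z,v)$ with \<open>vs\<close> in place of $v_i^*$.\<close>

definition subdiff_g ::
    "('n \<Rightarrow> 'x \<times> 'v \<Rightarrow> 'z \<times> 'u) \<Rightarrow> ('n \<Rightarrow> 'z::real_normed_vector \<times> 'u \<Rightarrow> real) \<Rightarrow>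
     'n \<Rightarrow> 'x \<Rightarrow> 'v \<Rightarrow> ('z \<Rightarrow>\<^sub>L real) set" where
  "subdiff_g G g i z v =
     limiting_subdiff (\<lambda>\<zeta>. g i (\<zeta>, snd (G i (z, v)))) (fst (G i (z, v)))"

definition subdiff_G ::
    "('n \<Rightarrow> 'x \<times> 'v \<Rightarrow> 'z \<times> 'u) \<Rightarrow> 'n \<Rightarrow> ('z::real_normed_vector \<Rightarrow>\<^sub>L real) \<Rightarrow>
     'x::real_normed_vector \<Rightarrow> 'v \<Rightarrow> ('x \<Rightarrow>\<^sub>L real) set" where
  "subdiff_G G i vs z v = limiting_subdiff (scalarize vs (\<lambda>x. fst (G i (x, v)))) z"

definition assumption_A1 ::
    "('x::metric_space \<Rightarrow> 'w::metric_space) \<Rightarrow> ('w \<Rightarrow> 'y::metric_space) \<Rightarrow> 'x \<Rightarrow> bool" where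
  "assumption_A1 F f xb \<longleftrightarrow> locally_lipschitz_at F xb \<and> locally_lipschitz_at f (F xb)"

definition assumption_A2 ::
    "('n \<Rightarrow> 'v topology) \<Rightarrow> ('n \<Rightarrow> 'x::metric_space \<times> 'v \<Rightarrow> 'z::metric_space \<times> 'u) \<Rightarrow>
     ('n \<Rightarrow> 'z \<times> 'u \<Rightarrow> real) \<Rightarrow> 'x \<Rightarrow> bool" where
  "assumption_A2 V G g xb \<longleftrightarrow> (\<forall>i.
     (\<exists>N L. open N \<and> xb \<in> N \<and> (\<forall>v \<in> topspace (V i). L-lipschitz_on N (\<lambda>x. fst (G i (x, v))))) \<and>
     (\<exists>\<delta> L. 0 < \<delta> \<and> (\<forall>v \<in> topspace (V i).
        L-lipschitz_on (ball (fst (G i (xb, v))) \<delta>) (\<lambda>\<zeta>. g i (\<zeta>, snd (G i (xb, v)))))))"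

definition assumption_A3 ::
    "('n \<Rightarrow> 'v topology) \<Rightarrow> ('n \<Rightarrow> 'u topology) \<Rightarrow>
     ('n \<Rightarrow> 'x \<times> 'v \<Rightarrow> 'z::metric_space \<times> 'u) \<Rightarrow> ('n \<Rightarrow> 'z \<times> 'u \<Rightarrow> real) \<Rightarrow> 'x \<Rightarrow> bool" where
  "assumption_A3 V U G g xb \<longleftrightarrow> (\<forall>i. \<exists>mV mU.
     mtopology_of mV = V i \<and> mtopology_of mU = U i \<and>
     locally_lipschitz_map mV (prod_metric euclidean_metric mU) (\<lambda>v. G i (xb, v)) \<and>
     locally_lipschitz_map
       (submetric (prod_metric euclidean_metric mU) ((\<lambda>v. G i (xb, v)) ` topspace (V i)))
       euclidean_metric (g i))"

definition assumption_A4 ::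
    "('n::finite \<Rightarrow> 'v topology) \<Rightarrow> ('n \<Rightarrow> 'x::metric_space \<times> 'v \<Rightarrow> 'z \<times> 'u) \<Rightarrow>
     ('n \<Rightarrow> 'z \<times> 'u \<Rightarrow> real) \<Rightarrow> 'x \<Rightarrow> bool" where
  "assumption_A4 V G g xb \<longleftrightarrow>
     (\<forall>i x. \<exists>v \<in> topspace (V i). \<forall>v' \<in> topspace (V i). g i (G i (x, v')) \<le> g i (G i (x, v))) \<and>
     (\<forall>i. locally_lipschitz_at (max_fun V G g i) xb) \<and>
     locally_lipschitz_at (\<lambda>x. MAX i. max_fun V G g i x) xb"

definition assumption_A5 ::
    "('n \<Rightarrow> 'v topology) \<Rightarrow> ('n \<Rightarrow> 'x::real_normed_vector \<times> 'v \<Rightarrow> 'z \<times> 'u) \<Rightarrow>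
     ('n \<Rightarrow> 'z \<times> 'u \<Rightarrow> real) \<Rightarrow> 'x \<Rightarrow> bool" where
  "assumption_A5 V G g xb \<longleftrightarrow> (\<forall>i. \<forall>vb \<in> active_set V G g i xb. \<forall>xs vs ls l.
     xs \<longlonglongrightarrow> xb \<longrightarrow>
     (\<forall>k. vs k \<in> topspace (V i)) \<longrightarrow> limitin (V i) vs vb sequentially \<longrightarrow>
     (\<forall>k. ls k \<in> limiting_subdiff (\<lambda>x. g i (G i (x, vs k))) (xs k)) \<longrightarrow>
     limitin weak_star ls l sequentially \<longrightarrow>
     l \<in> limiting_subdiff (\<lambda>x. g i (G i (x, vb))) xb)"

text \<open>The sums in \<open>dual_feasible_set\<close> are Minkowski sums of subsets of \<open>X\<^sup>*\<close>.\<close>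

definition dual_feasible_set ::
    "'y::real_normed_vector set \<Rightarrow> ('x::real_normed_vector \<Rightarrow> 'w::real_normed_vector) \<Rightarrow> ('w \<Rightarrow> 'y) \<Rightarrow>
     ('n::finite \<Rightarrow> 'v topology) \<Rightarrow> ('n \<Rightarrow> 'x \<times> 'v \<Rightarrow> 'z::real_normed_vector \<times> 'u) \<Rightarrow>
     ('n \<Rightarrow> 'z \<times> 'u \<Rightarrow> real) \<Rightarrow> ('x \<times> ('y \<Rightarrow>\<^sub>L real) \<times> (real ^ 'n)) set" where
  "dual_feasible_set K F f V G g = {(z, ys, \<mu>).
     ys \<in> dual_cone K - {0} \<and> (\<forall>i. 0 \<le> \<mu> $ i) \<and>
     0 \<in> (\<Union>ws \<in> limiting_subdiff (scalarize ys f) (F z). limiting_subdiff (scalarize ws F) z)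
        + (\<Sum>i\<in>UNIV. (\<lambda>l. (\<mu> $ i) *\<^sub>R l) `
             clco (\<Union>v \<in> active_set V G g i z. \<Union>vs \<in> subdiff_g G g i z v. subdiff_G G i vs z v)) \<and>
     (\<forall>i. \<forall>v \<in> active_set V G g i z. 0 \<le> (\<mu> $ i) * g i (G i (z, v)))}"

text \<open>In both notions of pseudo convexity the direction \<open>\<nu>\<close> may depend on \<open>x\<close>, \<open>y\<^sup>*\<close>, \<open>w\<^sup>*\<close>, \<open>x\<^sup>*\<close>
  but serves all constraint data (\<open>i\<close>, \<open>v\<^sub>i\<close>, \<open>v\<^sub>i\<^sup>*\<close>, \<open>x\<^sub>i\<^sup>*\<close>) simultaneously. A direction
  chosen separately for each tuple of these data would say nothing about convex
  combinations of several subgradients of one constraint, and such combinations occur in the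
  dual feasible set.\<close>

definition pseudo_convex_I ::
    "'y::real_normed_vector set \<Rightarrow> ('x::real_normed_vector \<Rightarrow> 'w::real_normed_vector) \<Rightarrow> ('w \<Rightarrow> 'y) \<Rightarrow>
     ('n \<Rightarrow> 'v topology) \<Rightarrow> ('n \<Rightarrow> 'x \<times> 'v \<Rightarrow> 'z::real_normed_vector \<times> 'u) \<Rightarrow>
     ('n \<Rightarrow> 'z \<times> 'u \<Rightarrow> real) \<Rightarrow> 'x \<Rightarrow> bool" where
  "pseudo_convex_I K F f V G g xb \<longleftrightarrow>
     (\<forall>x. \<forall>ys \<in> dual_cone K. \<forall>ws \<in> limiting_subdiff (scalarize ys f) (F xb).
      \<forall>xs \<in> limiting_subdiff (scalarize ws F) xb. \<exists>\<nu>.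
        (scalarize ys (f \<circ> F) x < scalarize ys (f \<circ> F) xb \<longrightarrow> blinfun_apply xs \<nu> < 0) \<and>
        (\<forall>i. \<forall>v \<in> active_set V G g i xb. \<forall>vs \<in> subdiff_g G g i xb v. \<forall>xi \<in> subdiff_G G i vs xb v.
           g i (G i (x, v)) \<le> g i (G i (xb, v)) \<longrightarrow> blinfun_apply xi \<nu> \<le> 0))"

definition pseudo_convex_II ::
    "'y::real_normed_vector set \<Rightarrow> ('x::real_normed_vector \<Rightarrow> 'w::real_normed_vector) \<Rightarrow> ('w \<Rightarrow> 'y) \<Rightarrow>
     ('n \<Rightarrow> 'v topology) \<Rightarrow> ('n \<Rightarrow> 'x \<times> 'v \<Rightarrow> 'z::real_normed_vector \<times> 'u) \<Rightarrow>
     ('n \<Rightarrow> 'z \<times> 'u \<Rightarrow> real) \<Rightarrow> 'x \<Rightarrow> bool" where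
  "pseudo_convex_II K F f V G g xb \<longleftrightarrow>
     (\<forall>x \<in> UNIV - {xb}. \<forall>ys \<in> dual_cone K - {0}. \<forall>ws \<in> limiting_subdiff (scalarize ys f) (F xb).
      \<forall>xs \<in> limiting_subdiff (scalarize ws F) xb. \<exists>\<nu>.
        (scalarize ys (f \<circ> F) x \<le> scalarize ys (f \<circ> F) xb \<longrightarrow> blinfun_apply xs \<nu> < 0) \<and>
        (\<forall>i. \<forall>v \<in> active_set V G g i xb. \<forall>vs \<in> subdiff_g G g i xb v. \<forall>xi \<in> subdiff_G G i vs xb v.
           g i (G i (x, v)) \<le> g i (G i (xb, v)) \<longrightarrow> blinfun_apply xi \<nu> \<le> 0))"

end

(* Write 0 = x* + sum_i mu_i b_i with b_i in the weak* closed convex hull of the active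
   subgradients. If some feasible x were better than xb, pseudo convexity would give a direction \<nu>
   with x* \<nu> < 0. Whenever mu_i > 0, complementarity and feasibility force the active constraint
   values at xb to vanish, so every active subgradient, and hence b_i, is nonpositive at \<nu>.
   Evaluating the sum at \<nu> gives the contradiction 0 < 0. *)
theory Submission
  imports Defs
begin

text \<open>Evaluation at \<nu> is linear and weak* continuous, so the functionals with value at
  most \<open>c\<close> at \<nu> form a convex weak* closed half-space. It contains
  \<open>clco S\<close> as soon as it contains \<open>S\<close>.\<close>

lemma clco_apply_le:
  assumes "l \<in> clco S" and "\<And>s. s \<in> S \<Longrightarrow> blinfun_apply s \<nu> \<le> c"
  shows "blinfun_apply l \<nu> \<le> c"
proof -
  let ?H = "{l. blinfun_apply l \<nu> \<le> c}"
  have "convex ?H"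
    by (auto simp: convex_def blinfun.add_left blinfun.scaleR_left intro: convex_bound_le)
  then have "convex hull S \<subseteq> ?H"
    using assms(2) by (intro hull_minimal) auto
  moreover have "closedin weak_star ?H"
    using closedin_continuous_map_preimage
      [OF strong_operator_topology_continuous_evaluation, of "{..c}" \<nu>]
    by (simp add: strong_operator_topology_topspace)
  ultimately show ?thesis
    using assms(1) closure_of_minimal unfolding clco_def by fastforce
qed

text \<open>If \<open>ys\<close> were nonpositive at an interior point of \<open>K\<close>, a short
  step in a direction where \<open>ys\<close> decreases would stay in \<open>K\<close> and make
  \<open>ys\<close> negative there.\<close>

lemma dual_cone_interior_pos:
  assumes "ys \<in> dual_cone K - {0}" and "y \<in> interior K"
  shows "0 < blinfun_apply ys y"
proof (rule ccontr)
  assume not_pos: "\<not> 0 < blinfun_apply ys y"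
  obtain z where z: "blinfun_apply ys z \<noteq> 0"
    using assms(1) blinfun_eqI[of ys 0] by auto
  \<comment> \<open>Scaling \<open>z\<close> by its own value makes \<open>ys d\<close> minus a
    square, so the sign of \<open>ys z\<close> does not matter.\<close>
  define d where "d = - blinfun_apply ys z *\<^sub>R z"
  have d: "blinfun_apply ys d < 0"
    using z by (auto simp: d_def blinfun.scaleR_right blinfun.minus_right zero_less_mult_iff)
  obtain e where e: "0 < e" "ball y e \<subseteq> K"
    using assms(2) by (auto simp: mem_interior)
  define t where "t = e / (2 * (norm d + 1))"
  have "0 < norm d + 1"
    by (simp add: add_nonneg_pos)
  then have "0 < t" "t * norm d < e"
    using e(1) by (auto simp: t_def field_simps intro: add_nonneg_pos)
  then have "y + t *\<^sub>R d \<in> ball y e"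
    by (simp add: dist_norm)
  then have "0 \<le> blinfun_apply ys (y + t *\<^sub>R d)"
    using e(2) assms(1) by (auto simp: dual_cone_def)
  moreover have "t * blinfun_apply ys d < 0"
    using \<open>0 < t\<close> d by (rule mult_pos_neg)
  ultimately show False
    using not_pos by (simp add: blinfun.add_right blinfun.scaleR_right)
qed

text \<open>Common core of both parts: \<open>descent\<close> is what either kind of pseudo
  convexity supplies for a feasible \<open>x\<close> better than \<open>xb\<close>. The direction
  \<nu> is chosen after \<open>ws\<close> and \<open>xs\<close> but before the constraint data, so
  the whole sum can be evaluated at one point.\<close>

lemma dual_feasible_no_descent_direction:
  assumes dual: "(xb, ys, \<mu>) \<in> dual_feasible_set K F f V G g"
    and feas: "xb \<in> feasible_set V G g" "x \<in> feasible_set V G g"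
    and descent: "\<And>ws xs. ws \<in> limiting_subdiff (scalarize ys f) (F xb) \<Longrightarrow>
      xs \<in> limiting_subdiff (scalarize ws F) xb \<Longrightarrow> \<exists>\<nu>. blinfun_apply xs \<nu> < 0 \<and>
        (\<forall>i. \<forall>v \<in> active_set V G g i xb. \<forall>vs \<in> subdiff_g G g i xb v. \<forall>xi \<in> subdiff_G G i vs xb v.
           g i (G i (x, v)) \<le> g i (G i (xb, v)) \<longrightarrow> blinfun_apply xi \<nu> \<le> 0)"
  shows False
proof -
  let ?S = "\<lambda>i. \<Union>v \<in> active_set V G g i xb. \<Union>vs \<in> subdiff_g G g i xb v. subdiff_G G i vs xb v"
  have \<mu>: "0 \<le> \<mu> $ i" for i
    using dual by (simp add: dual_feasible_set_def)
  have compl: "0 \<le> \<mu> $ i * g i (G i (xb, v))" if "v \<in> active_set V G g i xb" for i v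
    using dual that by (simp add: dual_feasible_set_def)
  have "0 \<in> (\<Union>ws \<in> limiting_subdiff (scalarize ys f) (F xb). limiting_subdiff (scalarize ws F) xb)
      + (\<Sum>i\<in>UNIV. (\<lambda>l. (\<mu> $ i) *\<^sub>R l) ` clco (?S i))"
    using dual by (simp add: dual_feasible_set_def)
  \<comment> \<open>Membership in the Minkowski sum amounts to a choice \<open>q\<close> of one
    summand per index.\<close>
  then obtain ws xs q where w: "ws \<in> limiting_subdiff (scalarize ys f) (F xb)"
      "xs \<in> limiting_subdiff (scalarize ws F) xb"
    and q: "\<And>i. q i \<in> (\<lambda>l. (\<mu> $ i) *\<^sub>R l) ` clco (?S i)" "0 = xs + (\<Sum>i\<in>UNIV. q i)"
    by (force simp: set_sum_alt elim!: set_plus_elim)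
  obtain \<nu> where neg: "blinfun_apply xs \<nu> < 0"
    and *: "\<And>i v vs xi. v \<in> active_set V G g i xb \<Longrightarrow> vs \<in> subdiff_g G g i xb v \<Longrightarrow>
      xi \<in> subdiff_G G i vs xb v \<Longrightarrow> g i (G i (x, v)) \<le> g i (G i (xb, v)) \<Longrightarrow> blinfun_apply xi \<nu> \<le> 0"
    using descent[OF w] by blast
  have "blinfun_apply (q i) \<nu> \<le> 0" for i
  proof -
    obtain b where b: "b \<in> clco (?S i)" "q i = (\<mu> $ i) *\<^sub>R b"
      using q(1)[of i] by auto
    show ?thesis
    \<comment> \<open>For a zero multiplier, complementarity says nothing about the sign of the
      constraint at \<open>xb\<close>, but then \<open>q i\<close> is zero.\<close>
    proof (cases "\<mu> $ i = 0")
      case False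
      then have pos: "0 < \<mu> $ i"
        using \<mu>[of i] by simp
      have "g i (G i (x, v)) \<le> g i (G i (xb, v))" if v: "v \<in> active_set V G g i xb" for v
      proof -
        have "g i (G i (x, v)) \<le> 0"
          using feas(2) v by (simp add: feasible_set_def active_set_def)
        \<comment> \<open>Dividing the complementarity condition by the positive multiplier gives
          the sign at \<open>xb\<close>.\<close>
        also have "0 \<le> g i (G i (xb, v))"
          using compl[OF v] pos by (simp add: zero_le_mult_iff)
        finally show ?thesis .
      qed
      then have "blinfun_apply b \<nu> \<le> 0"
        using b(1) * by (elim clco_apply_le) blast
      then show ?thesis
        using pos by (simp add: b(2) blinfun.scaleR_left mult_nonneg_nonpos)
    qed (simp add: b(2))
  qed
  then have "(\<Sum>i\<in>UNIV. blinfun_apply (q i) \<nu>) \<le> 0"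
    by (simp add: sum_nonpos)
  moreover have "0 = blinfun_apply xs \<nu> + (\<Sum>i\<in>UNIV. blinfun_apply (q i) \<nu>)"
    using arg_cong[OF q(2), of "\<lambda>l. blinfun_apply l \<nu>"]
    by (simp add: blinfun.add_left blinfun.sum_left)
  ultimately show False
    using neg by linarith
qed

theorem theorem4p4:
  fixes F :: "'x::banach \<Rightarrow> 'w::banach"
    and f :: "'w \<Rightarrow> 'y::banach"
    and K :: "'y set"
    and V :: "'n::finite \<Rightarrow> 'v topology"
    and U :: "'n \<Rightarrow> 'u topology"
    and G :: "'n \<Rightarrow> 'x \<times> 'v \<Rightarrow> 'z::banach \<times> 'u"
    and g :: "'n \<Rightarrow> 'z \<times> 'u \<Rightarrow> real"
    and xb :: 'x
    and yb :: "'y \<Rightarrow>\<^sub>L real"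
    and \<mu>b :: "real ^ 'n"
  assumes "asplund TYPE('x)" "asplund TYPE('w)" "asplund TYPE('y)" "asplund TYPE('z)"
    and "ordering_cone K"
    and "\<And>i. topspace (V i) \<noteq> {}" "\<And>i. seq_compact_space (V i)"
    and "\<And>i x v. v \<in> topspace (V i) \<Longrightarrow> snd (G i (x, v)) \<in> topspace (U i)"
    and "assumption_A1 F f xb"
    and "assumption_A2 V G g xb"
    and "assumption_A3 V U G g xb"
    and "assumption_A4 V G g xb"
    and "assumption_A5 V G g xb"
    and "(xb, yb, \<mu>b) \<in> dual_feasible_set K F f V G g"
    and "xb \<in> feasible_set V G g"
  shows "(pseudo_convex_I K F f V G g xb \<longrightarrow>
            weakly_efficient K (feasible_set V G g) (f \<circ> F) xb) \<and>
         (pseudo_convex_II K F f V G g xb \<longrightarrow>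
            efficient K (feasible_set V G g) (f \<circ> F) xb)"
proof (intro conjI impI)
  note dual = \<open>(xb, yb, \<mu>b) \<in> dual_feasible_set K F f V G g\<close>
  note feas = \<open>xb \<in> feasible_set V G g\<close>
  have yb: "yb \<in> dual_cone K - {0}"
    using dual by (simp add: dual_feasible_set_def)
  {
    assume pc: "pseudo_convex_I K F f V G g xb"
    have "(f \<circ> F) x - (f \<circ> F) xb \<notin> uminus ` interior K" if x: "x \<in> feasible_set V G g" for x
    proof
      assume "(f \<circ> F) x - (f \<circ> F) xb \<in> uminus ` interior K"
      then obtain k where "k \<in> interior K" "f (F x) - f (F xb) = - k"
        by auto
      \<comment> \<open>Since \<open>k\<close> is interior, the inequality is strict, as the premise
        in type I requires.\<close>
      then have "blinfun_apply yb (f (F x) - f (F xb)) < 0"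
        using dual_cone_interior_pos[OF yb] by (simp add: blinfun.minus_right)
      then have less: "scalarize yb (f \<circ> F) x < scalarize yb (f \<circ> F) xb"
        by (simp add: scalarize_def blinfun.diff_right)
      show False
        by (rule dual_feasible_no_descent_direction[OF dual feas x])
          (use pc yb less in \<open>fastforce simp: pseudo_convex_I_def\<close>)
    qed
    with feas show "weakly_efficient K (feasible_set V G g) (f \<circ> F) xb"
      by (simp add: weakly_efficient_def)
  }
  {
    assume pc: "pseudo_convex_II K F f V G g xb"
    have "(f \<circ> F) x - (f \<circ> F) xb \<notin> uminus ` K - {0}" if x: "x \<in> feasible_set V G g" for x
    proof
      assume better: "(f \<circ> F) x - (f \<circ> F) xb \<in> uminus ` K - {0}"
      \<comment> \<open>Removing 0 from the cone excludes \<open>x = xb\<close>, a point that type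
        II does not cover.\<close>
      then have ne: "x \<in> UNIV - {xb}"
        by auto
      obtain k where "k \<in> K" "f (F x) - f (F xb) = - k"
        using better by auto
      \<comment> \<open>A nonzero \<open>k\<close> on the boundary of \<open>K\<close> may be
        annihilated by \<open>yb\<close>, so only the weak inequality is available; type II has it
        as its premise.\<close>
      then have "blinfun_apply yb (f (F x) - f (F xb)) \<le> 0"
        using yb by (simp add: dual_cone_def blinfun.minus_right)
      then have le: "scalarize yb (f \<circ> F) x \<le> scalarize yb (f \<circ> F) xb"
        by (simp add: scalarize_def blinfun.diff_right)
      show False
        by (rule dual_feasible_no_descent_direction[OF dual feas x])
          (use pc yb le ne in \<open>fastforce simp: pseudo_convex_II_def\<close>)
    qed
    with feas show "efficient K (feasible_set V G g) (f \<circ> F) xb"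
      by (simp add: efficient_def)
  }
qed

end
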